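(* Suppose $f$ and $g$ are quasisymmetric functions with coefficients in $\mathbb{Z}$ in countably infinitely many variables $x_1,x_2,x_3,\ldots$, and $f\cdot g$ is symmetric. Then both $f$ and $g$ are symmetric.
   Context: A quasisymmetric function over $\mathbb{Z}$ in $x_1,x_2,\ldots$ is a formal power series of bounded degree with integer coefficients such that, for every composition $\alpha=(\alpha_1,\ldots,\alpha_m)$ (finite sequence of positive integers) and every $i_1<i_2<\cdots<i_m$, the coefficient of $x_{i_1}^{\alpha_1}\cdots x_{i_m}^{\alpha_m}$ equals the coefficient of $x_1^{\alpha_1}\cdots x_m^{\alpha_m}$. It need not be homogeneous. A symmetric function is a bounded-degree formal power series over $\mathbb{Z}$ in $x_1,x_2,\ldots$ that is invariant under all permutations of the variables.
   Formalization: The formal theorem additionally assumes that f and g are both nonzero; without this the claim fails, e.g. for f = 0 and g the sum of x_i x_j^2 over i < j. *)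

theory Defs
  imports "HOL-Library.Poly_Mapping"
begin

text \<open>
  Exponent vectors of monomials are finitely supported functions from variable indices to
  exponents; index \<open>i :: nat\<close> stands for the variable $x_{i+1}$. A formal power series is an
  arbitrary coefficient function on monomials (no finiteness condition, in contrast to
  \<open>\<Rightarrow>\<^sub>0\<close>-based polynomials).
\<close>

type_synonym monom = "nat \<Rightarrow>\<^sub>0 nat"
type_synonym 'a series = "monom \<Rightarrow> 'a"

definition mdegree :: "monom \<Rightarrow> nat" where
  "mdegree m = (\<Sum>i\<in>Poly_Mapping.keys m. Poly_Mapping.lookup m i)"

definition bounded_degree :: "'a::zero series \<Rightarrow> bool" where
  "bounded_degree f \<longleftrightarrow> (\<exists>d. \<forall>m. f m \<noteq> 0 \<longrightarrow> mdegree m \<le> d)"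

definition series_mult :: "'a::comm_semiring_0 series \<Rightarrow> 'a series \<Rightarrow> 'a series"
    (infixl "\<odot>" 70) where
  "f \<odot> g = (\<lambda>m. \<Sum>(a, b)\<in>{(a, b). a + b = m}. f a * g b)"

text \<open>The index set of the sum in the product is always finite, so the sum is never
  the default value of an infinite sum.\<close>

lemma finite_monom_splittings: "finite {(a, b). a + b = (m :: monom)}"
proof -
  define F where "F = {h. \<forall>i. (i \<in> Poly_Mapping.keys m \<longrightarrow> h i \<in> {..Poly_Mapping.lookup m i}) \<and> (i \<notin> Poly_Mapping.keys m \<longrightarrow> h i = (0::nat))}"
  have "F \<subseteq> {h. \<forall>i. (i \<in> Poly_Mapping.keys m \<longrightarrow> h i \<in> (\<Union>j\<in>Poly_Mapping.keys m. {..Poly_Mapping.lookup m j})) \<and> (i \<notin> Poly_Mapping.keys m \<longrightarrow> h i = 0)}"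
    unfolding F_def by blast
  moreover have "finite \<dots>"
    by (rule finite_set_of_finite_funs) auto
  ultimately have "finite F"
    by (rule finite_subset)
  have le: "Poly_Mapping.lookup a i \<le> Poly_Mapping.lookup m i \<and> Poly_Mapping.lookup b i \<le> Poly_Mapping.lookup m i" if "a + b = m" for a b i
    using that by (auto simp: lookup_add)
  have "Poly_Mapping.lookup a \<in> F \<and> Poly_Mapping.lookup b \<in> F" if "a + b = m" for a b
    using le[OF that] by (auto simp: F_def in_keys_iff) (metis le_zero_eq)+
  hence "(\<lambda>(a, b). (Poly_Mapping.lookup a, Poly_Mapping.lookup b)) ` {(a, b). a + b = m} \<subseteq> F \<times> F"
    by auto
  moreover have "inj_on (\<lambda>(a, b). (Poly_Mapping.lookup a, Poly_Mapping.lookup b)) {(a, b). a + b = m}"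
    by (auto simp: inj_on_def lookup_inject)
  ultimately show ?thesis
    using \<open>finite F\<close> by (meson finite_SigmaI inj_on_finite)
qed

text \<open>\<open>monom_of [i\<^sub>1, \<dots>, i\<^sub>m] [\<alpha>\<^sub>1, \<dots>, \<alpha>\<^sub>m]\<close> is the monomial with exponent \<open>\<alpha>\<^sub>k\<close> at index \<open>i\<^sub>k\<close>.\<close>

definition monom_of :: "nat list \<Rightarrow> nat list \<Rightarrow> monom" where
  "monom_of is \<alpha> = sum_list (map2 Poly_Mapping.single is \<alpha>)"

definition composition :: "nat list \<Rightarrow> bool" where
  "composition \<alpha> \<longleftrightarrow> (\<forall>a\<in>set \<alpha>. a > 0)"

definition quasisymmetric :: "'a::zero series \<Rightarrow> bool" where
  "quasisymmetric f \<longleftrightarrow> bounded_degree f \<and>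
     (\<forall>\<alpha> is. composition \<alpha> \<and> length is = length \<alpha> \<and> sorted_wrt (<) is \<longrightarrow>
        f (monom_of is \<alpha>) = f (monom_of [0..<length \<alpha>] \<alpha>))"

text \<open>For injective \<open>\<pi>\<close>, \<open>Poly_Mapping.map_key \<pi> m\<close> is the exponent vector \<open>\<lambda>i. Poly_Mapping.lookup m (\<pi> i)\<close>.
  Hence \<open>permute_vars \<pi> f\<close> is the series obtained from \<open>f\<close> by substituting the variable with
  index \<open>\<pi> i\<close> for the one with index \<open>i\<close>.\<close>

definition permute_vars :: "(nat \<Rightarrow> nat) \<Rightarrow> 'a series \<Rightarrow> 'a series" where
  "permute_vars \<pi> f = (\<lambda>m. f (Poly_Mapping.map_key \<pi> m))"

definition symmetric :: "'a::zero series \<Rightarrow> bool" where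
  "symmetric f \<longleftrightarrow> bounded_degree f \<and> (\<forall>\<pi>. bij \<pi> \<longrightarrow> permute_vars \<pi> f = f)"

end

theory Submission
  imports Defs "HOL-Computational_Algebra.Polynomial_Factorial" "HOL-Combinatorics.Transposition"
begin

text \<open>
  Write $x_0$ for the variable of index 0 and $F = f \cdot g$. The factor $f$ is shown to be symmetric
  by induction on its degree; $g$ follows because the product commutes.

  View $f = \sum_i x_0^i f_i$ as a polynomial in $x_0$ over the series in the remaining variables, and
  let $f_a$ and $g_b$ be the leading coefficients of $f$ and $g$. After renumbering the variables,
  $f_a$ and $g_b$ are again quasisymmetric, and their product is the coefficient of $x_0^{a+b}$ in $F$,
  which is symmetric. If $a = 0$, then $x_0$ does not occur in $f$, and a quasisymmetric series with
  this property is constant. If $a > 0$, then $f_a$ has smaller degree than $f$, so $f_a$ is symmetric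
  by induction.

  Every permutation $\tau$ of the variables that fixes $x_0$ gives $F = \tau f \cdot \tau g$, so $\tau f$
  divides $F$; and since $f_a$ is symmetric, $\tau f$ has the leading coefficient $f_a$ for all $\tau$.
  Over a field, unique factorization allows a nonzero polynomial of degree $d$ at most $2^d$ divisors
  with a prescribed leading coefficient; passing to fractions, the same holds over an integral domain
  (\<open>card_poly_divisors_with_lead_coeff\<close>). Setting all variables from some index on to 0 makes the
  coefficients polynomials, which form an integral domain, and does not affect the bound $2^d$, where
  $d$ bounds the degree of $F$. Hence among more than $2^d$ disjoint transpositions $\tau_j$ of
  neighbouring variables, two satisfy $\tau_j f = \tau_k f$ up to that truncation.

  Now compare coefficients at a monomial in which the variables moved by $\tau_k$ do not occur and the
  two variables moved by $\tau_j$ carry two adjacent parts of a given composition. By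
  quasisymmetry such a monomial exists for every composition and every pair of adjacent parts, so the
  coefficients of $f$ do not change when two adjacent parts are exchanged
  (\<open>adjacent_swap_if_top_x0coeff_symmetric\<close>). Adjacent exchanges generate all rearrangements, and
  $f$ is symmetric.
\<close>

section \<open>Divisors with a prescribed leading coefficient\<close>

lemma field_poly_prime_divisor_exists:
  fixes p :: "'a::field poly"
  assumes "degree p > 0"
  shows "\<exists>q. q dvd p \<and> prime_elem q \<and> degree q > 0"
  using assms
proof (induction "degree p" arbitrary: p rule: less_induct)
  case less
  show ?case
  proof (cases "irreducible p")
    case True
    then show ?thesis using less.prems field_poly_irreducible_imp_prime[OF True] by (intro exI[of _ p]) simp
  next
    case False
    have p0: "p \<noteq> 0" using less.prems by auto
    have nu: "\<not> p dvd 1" using less.prems by (simp add: is_unit_iff_degree p0)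
    from False p0 nu obtain a b where ab: "p = a * b" "\<not> a dvd 1" "\<not> b dvd 1"
      unfolding irreducible_def by blast
    with p0 have "degree a > 0" "degree b > 0" "degree p = degree a + degree b"
      by (auto simp: is_unit_iff_degree degree_mult_eq)
    then obtain q where "q dvd a" "prime_elem q" "degree q > 0" using less.hyps[of a] by auto
    then show ?thesis using ab(1) by (meson dvd_mult2)
  qed
qed

text \<open>
  Split off a prime factor $r$ of $p = r s$ and induct on the degree: a divisor of $p$ that is not
  divisible by $r$ divides $s$, and one that is divisible by $r$ is $r$ times a divisor of $s$. So each
  prime factor at most doubles the number of divisors. Prescribing the leading coefficient picks at most one
  representative of each class of associates, which makes the count finite.
\<close>

lemma card_field_poly_divisors_with_lead_coeff:
  fixes p :: "'a::field poly"
  assumes "p \<noteq> 0"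
  shows "finite {q. q dvd p \<and> lead_coeff q = c} \<and> card {q. q dvd p \<and> lead_coeff q = c} \<le> 2 ^ degree p"
  using assms
proof (induction "degree p" arbitrary: p c rule: less_induct)
  case less
  let ?D = "\<lambda>p c. {q. q dvd p \<and> lead_coeff q = c}"
  show ?case
  proof (cases "degree p = 0")
    case True
    have "?D p c \<subseteq> {[:c:]}"
    proof
      fix q assume "q \<in> ?D p c"
      moreover from this have "degree q = 0" using True less.prems by (auto dest: dvd_imp_degree_le)
      ultimately show "q \<in> {[:c:]}" by (auto elim!: degree_eq_zeroE)
    qed
    then show ?thesis using True by (auto intro: finite_subset dest: card_mono[rotated])
  next
    case False
    then obtain r where r: "r dvd p" "prime_elem r" "degree r > 0"
      using field_poly_prime_divisor_exists by blast
    then obtain s where s: "p = r * s" by (elim dvdE)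
    have nz: "r \<noteq> 0" "s \<noteq> 0" using s less.prems by auto
    have deg: "degree s < degree p" "Suc (degree s) \<le> degree p" using r nz by (simp_all add: s degree_mult_eq)
    let ?c = "c / lead_coeff r"
    have IH: "finite (?D s c')" "card (?D s c') \<le> 2 ^ degree s" for c'
      using less.hyps[OF deg(1) nz(2)] by blast+
    have sub: "?D p c \<subseteq> ?D s c \<union> (*) r ` ?D s ?c"
    proof
      fix q assume q: "q \<in> ?D p c"
      then obtain u where u: "r * s = q * u" unfolding s dvd_def by blast
      then have "r dvd q * u" by (metis dvd_triv_left)
      then consider "r dvd q" | "r dvd u" using prime_elem_dvd_multD[OF r(2)] by blast
      then show "q \<in> ?D s c \<union> (*) r ` ?D s ?c"
      proof cases
        case 1
        then obtain v where v: "q = r * v" by (elim dvdE)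
        with u nz have "s = v * u" by (simp add: mult.assoc)
        moreover have "lead_coeff v = ?c" using q v nz by (auto simp: lead_coeff_mult)
        ultimately show ?thesis using v by auto
      next
        case 2
        then obtain v where v: "u = r * v" by (elim dvdE)
        with u nz have "s = q * v" by (simp add: mult.left_commute)
        then show ?thesis using q by auto
      qed
    qed
    have fin: "finite (?D s c \<union> (*) r ` ?D s ?c)" using IH by blast
    have "card (?D p c) \<le> card (?D s c \<union> (*) r ` ?D s ?c)" using sub fin by (rule card_mono[rotated])
    also have "\<dots> \<le> card (?D s c) + card ((*) r ` ?D s ?c)" by (rule card_Un_le)
    also have "\<dots> \<le> card (?D s c) + card (?D s ?c)" using card_image_le[OF IH(1)] by simp
    also have "\<dots> \<le> 2 ^ Suc (degree s)" using IH(2)[of c] IH(2)[of ?c] by simp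
    also have "\<dots> \<le> 2 ^ degree p" using deg(2) by (intro power_increasing) auto
    finally show ?thesis using finite_subset[OF sub fin] by blast
  qed
qed

text \<open>
  Divisibility and leading coefficients survive the passage to the field of fractions, which is
  injective on polynomials.
\<close>

lemma card_poly_divisors_with_lead_coeff:
  fixes p :: "'a::idom poly"
  assumes "p \<noteq> 0"
  shows "finite {q. q dvd p \<and> lead_coeff q = c}" and "card {q. q dvd p \<and> lead_coeff q = c} \<le> 2 ^ degree p"
proof -
  let ?h = "map_poly to_fract :: 'a poly \<Rightarrow> 'a fract poly"
  let ?D = "{q. q dvd p \<and> lead_coeff q = c}" and ?E = "{q. q dvd ?h p \<and> lead_coeff q = to_fract c}"
  have deg: "degree (?h q) = degree q" for q by (rule degree_map_poly) simp
  have E: "finite ?E" "card ?E \<le> 2 ^ degree p"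
    using card_field_poly_divisors_with_lead_coeff[of "?h p" "to_fract c"] assms
    by (simp_all only: fract_poly_eq_0_iff deg not_False_eq_True simp_thms)
  have sub: "?h ` ?D \<subseteq> ?E"
  proof (rule image_subsetI)
    fix q assume q: "q \<in> ?D"
    then have "?h q dvd ?h p" by (intro fract_poly_dvd) simp
    moreover have "lead_coeff (?h q) = to_fract c" using q unfolding deg by (simp add: coeff_map_poly)
    ultimately show "?h q \<in> ?E" by blast
  qed
  have inj: "inj_on ?h ?D" by (rule inj_onI) (simp only: fract_poly_eq_iff)
  show "finite ?D" using inj_on_finite[OF inj sub E(1)] .
  show "card ?D \<le> 2 ^ degree p" using order_trans[OF card_inj_on_le[OF inj sub E(1)] E(2)] .
qed

section \<open>Functions of lists that are invariant under adjacent swaps\<close>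

text \<open>
  The set \<open>A\<close> restricts attention to lists with admissible entries; below these are the positive
  numbers, so that the lists are compositions.
\<close>

lemma mset_eq_imp_eq_if_adjacent_swap_invariant:
  assumes swap: "\<And>us a b vs. set (us @ [a, b] @ vs) \<subseteq> A \<Longrightarrow> c (us @ [a, b] @ vs) = c (us @ [b, a] @ vs)"
    and "set xs \<subseteq> A" "mset xs = mset ys"
  shows "c xs = c ys"
proof -
  \<comment> \<open>Adjacent swaps bring any element to the front of a segment; the rest is then
    rearranged by induction.\<close>
  have move: "c (ws @ us @ x # vs) = c (ws @ x # us @ vs)" if "set (ws @ us @ x # vs) \<subseteq> A" for ws us vs x
    using that
  proof (induction us arbitrary: vs rule: rev_induct)
    case (snoc u us)
    then show ?case using snoc.IH[of "u # vs"] swap[of "ws @ us" u x vs] by auto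
  qed simp
  have "c (ws @ xs) = c (ws @ ys)" if "set (ws @ xs) \<subseteq> A" "mset xs = mset ys" for ws
    using that
  proof (induction xs arbitrary: ws ys)
    case (Cons x xs)
    then have "x \<in> set ys" by (metis list.set_intros(1) set_mset_mset)
    then obtain us vs where ys: "ys = us @ x # vs" by (meson split_list)
    have "c (ws @ x # xs) = c (ws @ x # us @ vs)"
      using Cons.IH[of "ws @ [x]" "us @ vs"] Cons.prems ys by simp
    also have "\<dots> = c (ws @ us @ x # vs)"
      using move[of ws us x vs] Cons.prems ys by (metis mset_append mset_eq_setD set_append)
    finally show ?case using ys by simp
  qed simp
  from this[of "[]"] assms show ?thesis by simp
qed

section \<open>Degrees, products and permutations of series\<close>

lemma keys_add_monom: "Poly_Mapping.keys (a + b :: monom) = Poly_Mapping.keys a \<union> Poly_Mapping.keys b"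
  by (auto simp: in_keys_iff lookup_add)

lemma mdegree_eq_sum_superset:
  assumes "finite A" "Poly_Mapping.keys m \<subseteq> A"
  shows "mdegree m = (\<Sum>i\<in>A. Poly_Mapping.lookup m i)"
  unfolding mdegree_def using assms by (intro sum.mono_neutral_left) (auto simp: in_keys_iff)

lemma mdegree_add: "mdegree (a + b) = mdegree a + mdegree b"
proof -
  let ?A = "Poly_Mapping.keys a \<union> Poly_Mapping.keys b"
  have "mdegree a = (\<Sum>i\<in>?A. Poly_Mapping.lookup a i)" "mdegree b = (\<Sum>i\<in>?A. Poly_Mapping.lookup b i)"
    "mdegree (a + b) = (\<Sum>i\<in>?A. Poly_Mapping.lookup (a + b) i)"
    by (rule mdegree_eq_sum_superset; auto simp: keys_add_monom)+
  then show ?thesis by (simp add: lookup_add sum.distrib)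
qed

lemma finite_monoms_bounded_degree:
  assumes "finite A"
  shows "finite {m :: monom. Poly_Mapping.keys m \<subseteq> A \<and> mdegree m \<le> d}" (is "finite ?M")
proof (rule inj_on_finite)
  show "inj_on Poly_Mapping.lookup ?M" by (simp add: inj_on_def)
  let ?H = "{h. \<forall>i. (i \<in> A \<longrightarrow> h i \<in> {..d}) \<and> (i \<notin> A \<longrightarrow> h i = 0)}"
  show "finite ?H" using assms by (rule finite_set_of_finite_funs) simp
  show "Poly_Mapping.lookup ` ?M \<subseteq> ?H"
  proof (rule image_subsetI)
    fix m assume m: "m \<in> ?M"
    have "Poly_Mapping.lookup m i \<le> d" if "i \<in> A" for i
    proof -
      have "Poly_Mapping.lookup m i \<le> (\<Sum>i\<in>A. Poly_Mapping.lookup m i)"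
        using assms that by (intro member_le_sum) auto
      also have "\<dots> \<le> d" using m assms by (simp flip: mdegree_eq_sum_superset)
      finally show ?thesis .
    qed
    then show "Poly_Mapping.lookup m \<in> ?H" using m by (auto simp: in_keys_iff)
  qed
qed

lemma bounded_degree_mult:
  assumes "bounded_degree f" "bounded_degree g"
  shows "bounded_degree (f \<odot> g)"
proof -
  obtain d e where d: "\<And>m. f m \<noteq> 0 \<Longrightarrow> mdegree m \<le> d" and e: "\<And>m. g m \<noteq> 0 \<Longrightarrow> mdegree m \<le> e"
    using assms unfolding bounded_degree_def by blast
  have "mdegree m \<le> d + e" if "(f \<odot> g) m \<noteq> 0" for m
  proof -
    from that obtain a b where "a + b = m" "f a * g b \<noteq> 0"
      unfolding series_mult_def by (force elim!: sum.not_neutral_contains_not_neutral)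
    then show ?thesis using d[of a] e[of b] by (metis add_mono mdegree_add mult_zero_left mult_zero_right)
  qed
  then show ?thesis unfolding bounded_degree_def by blast
qed

lemma series_mult_commute: "f \<odot> g = g \<odot> f"
proof
  fix m
  show "(f \<odot> g) m = (g \<odot> f) m"
    unfolding series_mult_def
    by (rule sum.reindex_bij_witness[where i = prod.swap and j = prod.swap]) (auto simp: ac_simps)
qed

lemma lookup_map_key: "inj \<pi> \<Longrightarrow> Poly_Mapping.lookup (Poly_Mapping.map_key \<pi> m) i = Poly_Mapping.lookup m (\<pi> i)"
  by (simp add: map_key.rep_eq)

lemma permute_vars_mult:
  assumes "bij \<pi>"
  shows "permute_vars \<pi> (f \<odot> g) = permute_vars \<pi> f \<odot> permute_vars \<pi> g"
proof
  fix m
  have inj: "inj \<pi>" "inj (inv \<pi>)" using assms by (auto intro: bij_is_inj bij_imp_bij_inv)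
  have inv: "Poly_Mapping.map_key \<pi> (Poly_Mapping.map_key (inv \<pi>) a) = a"
    "Poly_Mapping.map_key (inv \<pi>) (Poly_Mapping.map_key \<pi> a) = a" for a :: monom
    using assms by (auto intro!: poly_mapping_eqI simp: lookup_map_key inj bij_is_inj bij_is_surj surj_f_inv_f inv_f_f)
  show "permute_vars \<pi> (f \<odot> g) m = (permute_vars \<pi> f \<odot> permute_vars \<pi> g) m"
    unfolding permute_vars_def series_mult_def
    by (rule sum.reindex_bij_witness[where j = "map_prod (Poly_Mapping.map_key (inv \<pi>)) (Poly_Mapping.map_key (inv \<pi>))"
          and i = "map_prod (Poly_Mapping.map_key \<pi>) (Poly_Mapping.map_key \<pi>)"])
       (auto simp: inv inj simp flip: map_key_plus)
qed

lemma bounded_degree_permute_vars: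
  fixes f :: "'a::zero series"
  assumes "bij \<pi>" "bounded_degree f"
  shows "bounded_degree (permute_vars \<pi> f)"
proof -
  have "mdegree (Poly_Mapping.map_key \<pi> m) = mdegree m" for m :: monom
  proof -
    have inj: "inj \<pi>" using assms(1) by (rule bij_is_inj)
    have "mdegree (Poly_Mapping.map_key \<pi> m) = (\<Sum>i\<in>\<pi> -` Poly_Mapping.keys m. Poly_Mapping.lookup m (\<pi> i))"
      unfolding mdegree_def by (simp add: keys_map_key lookup_map_key inj)
    also have "\<dots> = (\<Sum>i\<in>\<pi> ` (\<pi> -` Poly_Mapping.keys m). Poly_Mapping.lookup m i)"
      by (subst sum.reindex) (auto intro: inj_on_subset[OF inj])
    also have "\<pi> ` (\<pi> -` Poly_Mapping.keys m) = Poly_Mapping.keys m"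
      using assms(1) by (simp add: bij_is_surj)
    finally show ?thesis by (simp add: mdegree_def)
  qed
  with assms(2) show ?thesis unfolding bounded_degree_def permute_vars_def by metis
qed

section \<open>Expansion in the variable of index 0\<close>

text \<open>
  The monomial $x_0^k \cdot m(x_1, x_2, \ldots)$: renumbering the variables of \<open>m\<close> makes the
  coefficients of a series with respect to $x_0$ series in the same variables again, so that the induction
  on the degree applies to them.
\<close>

definition cons_monom :: "nat \<Rightarrow> monom \<Rightarrow> monom" where
  "cons_monom k m = Abs_poly_mapping (case_nat k (Poly_Mapping.lookup m))"

lemma lookup_cons_monom: "Poly_Mapping.lookup (cons_monom k m) = case_nat k (Poly_Mapping.lookup m)"
proof -
  have "{i. case_nat k (Poly_Mapping.lookup m) i \<noteq> 0} \<subseteq> insert 0 (Suc ` {j. Poly_Mapping.lookup m j \<noteq> 0})"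
  proof
    fix i assume "i \<in> {i. case_nat k (Poly_Mapping.lookup m) i \<noteq> 0}"
    then show "i \<in> insert 0 (Suc ` {j. Poly_Mapping.lookup m j \<noteq> 0})" by (cases i) auto
  qed
  then have "finite {i. case_nat k (Poly_Mapping.lookup m) i \<noteq> 0}"
    by (rule finite_subset) simp
  then show ?thesis unfolding cons_monom_def by simp
qed

lemma lookup_cons_monom_simps [simp]:
  "Poly_Mapping.lookup (cons_monom k m) 0 = k"
  "Poly_Mapping.lookup (cons_monom k m) (Suc i) = Poly_Mapping.lookup m i"
  by (simp_all add: lookup_cons_monom)

lemma cons_monom_eqI:
  assumes "Poly_Mapping.lookup M 0 = k" "\<And>i. Poly_Mapping.lookup M (Suc i) = Poly_Mapping.lookup m i"
  shows "M = cons_monom k m"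
proof (rule poly_mapping_eqI)
  fix i show "Poly_Mapping.lookup M i = Poly_Mapping.lookup (cons_monom k m) i"
    using assms by (cases i) auto
qed

lemma cons_monom_eq_iff [simp]: "cons_monom k m = cons_monom l n \<longleftrightarrow> k = l \<and> m = n"
proof
  assume *: "cons_monom k m = cons_monom l n"
  have "Poly_Mapping.lookup m i = Poly_Mapping.lookup n i" for i
    using arg_cong[OF *, of "\<lambda>M. Poly_Mapping.lookup M (Suc i)"] by simp
  moreover have "k = l" using arg_cong[OF *, of "\<lambda>M. Poly_Mapping.lookup M 0"] by simp
  ultimately show "k = l \<and> m = n" by (auto intro: poly_mapping_eqI)
qed simp

lemma cons_monom_exhaust:
  obtains k m where "M = cons_monom k m"
proof
  show "M = cons_monom (Poly_Mapping.lookup M 0) (Poly_Mapping.map_key Suc M)"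
    by (rule cons_monom_eqI) (simp_all add: lookup_map_key)
qed

lemma cons_monom_add: "cons_monom k a + cons_monom l b = cons_monom (k + l) (a + b)"
  by (rule cons_monom_eqI) (simp_all add: lookup_add)

lemma keys_cons_monom:
  "Poly_Mapping.keys (cons_monom k m) = (if k = 0 then {} else {0}) \<union> Suc ` Poly_Mapping.keys m"
proof -
  have "i \<in> Poly_Mapping.keys (cons_monom k m) \<longleftrightarrow> i \<in> (if k = 0 then {} else {0}) \<union> Suc ` Poly_Mapping.keys m" for i
    by (cases i) (auto simp: in_keys_iff)
  then show ?thesis by blast
qed

lemma mdegree_cons_monom: "mdegree (cons_monom k m) = k + mdegree m"
proof -
  have "mdegree (cons_monom k m) = (\<Sum>i\<in>insert 0 (Suc ` Poly_Mapping.keys m). Poly_Mapping.lookup (cons_monom k m) i)"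
    by (rule mdegree_eq_sum_superset) (auto simp: keys_cons_monom)
  also have "\<dots> = k + mdegree m"
    by (subst sum.insert) (auto simp: mdegree_def sum.reindex)
  finally show ?thesis .
qed

definition fix0 :: "(nat \<Rightarrow> nat) \<Rightarrow> nat \<Rightarrow> nat" where
  "fix0 \<rho> = case_nat 0 (Suc \<circ> \<rho>)"

lemma inj_fix0: "inj \<rho> \<Longrightarrow> inj (fix0 \<rho>)"
proof (rule injI)
  fix x y assume "inj \<rho>" "fix0 \<rho> x = fix0 \<rho> y"
  then show "x = y" by (cases x; cases y) (auto simp: fix0_def dest: injD)
qed

lemma bij_fix0:
  assumes "bij \<rho>"
  shows "bij (fix0 \<rho>)"
proof -
  have "surj (fix0 \<rho>)"
    unfolding surj_def
  proof
    fix y show "\<exists>x. y = fix0 \<rho> x"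
    proof (cases y)
      case 0
      then show ?thesis by (intro exI[of _ 0]) (simp add: fix0_def)
    next
      case (Suc j)
      obtain i where "j = \<rho> i" using bij_is_surj[OF assms] by (auto simp: surj_def)
      then show ?thesis using Suc by (intro exI[of _ "Suc i"]) (simp add: fix0_def)
    qed
  qed
  then show ?thesis using inj_fix0 assms by (auto simp: bij_def)
qed

lemma map_key_fix0_cons_monom:
  assumes "inj \<rho>"
  shows "Poly_Mapping.map_key (fix0 \<rho>) (cons_monom k m) = cons_monom k (Poly_Mapping.map_key \<rho> m)"
  by (rule cons_monom_eqI) (simp_all add: lookup_map_key inj_fix0 assms, simp_all add: fix0_def)

definition x0coeff :: "'a series \<Rightarrow> nat \<Rightarrow> 'a series" where
  "x0coeff f k = (\<lambda>m. f (cons_monom k m))"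

lemma x0coeff_permute_vars:
  "inj \<rho> \<Longrightarrow> x0coeff (permute_vars (fix0 \<rho>) f) k = permute_vars \<rho> (x0coeff f k)"
  by (simp add: x0coeff_def permute_vars_def map_key_fix0_cons_monom)

lemma bounded_degree_x0coeff: "bounded_degree f \<Longrightarrow> bounded_degree (x0coeff f k)"
  unfolding bounded_degree_def x0coeff_def by (metis mdegree_cons_monom add_leD2)

text \<open>
  Monomials of the form \<open>cons_monom k m\<close> split by splitting \<open>k\<close> and \<open>m\<close> independently.
\<close>

lemma x0coeff_mult:
  "x0coeff (f \<odot> g) k m = (\<Sum>i\<le>k. (x0coeff f i \<odot> x0coeff g (k - i)) m)"
proof -
  let ?S = "{(a, b). a + b = m}" and ?T = "{(a, b). a + b = cons_monom k m}"
  have "(\<Sum>i\<le>k. (x0coeff f i \<odot> x0coeff g (k - i)) m)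
      = (\<Sum>(i, p)\<in>{..k} \<times> ?S. x0coeff f i (fst p) * x0coeff g (k - i) (snd p))"
    unfolding series_mult_def by (simp add: sum.cartesian_product split_def)
  also have "\<dots> = (\<Sum>(a, b)\<in>?T. f a * g b)"
  proof (rule sum.reindex_bij_witness[where
        j = "\<lambda>(i, p). (cons_monom i (fst p), cons_monom (k - i) (snd p))" and
        i = "\<lambda>(a, b). (Poly_Mapping.lookup a 0, Poly_Mapping.map_key Suc a, Poly_Mapping.map_key Suc b)"])
    have tl: "Poly_Mapping.map_key Suc (cons_monom i a) = a" for i a
      by (rule poly_mapping_eqI) (simp add: lookup_map_key)
    fix q
    { assume "q \<in> {..k} \<times> ?S"
      then show "(\<lambda>(a, b). (Poly_Mapping.lookup a 0, Poly_Mapping.map_key Suc a, Poly_Mapping.map_key Suc b))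
          ((\<lambda>(i, p). (cons_monom i (fst p), cons_monom (k - i) (snd p))) q) = q"
        "(\<lambda>(i, p). (cons_monom i (fst p), cons_monom (k - i) (snd p))) q \<in> ?T"
        by (auto simp: tl cons_monom_add) }
    { assume "q \<in> ?T"
      then obtain a b where q: "q = (a, b)" "a + b = cons_monom k m" by blast
      obtain i a' where a: "a = cons_monom i a'" by (rule cons_monom_exhaust)
      obtain j b' where b: "b = cons_monom j b'" by (rule cons_monom_exhaust)
      have ij: "i + j = k" "a' + b' = m" using q by (auto simp: a b cons_monom_add)
      show "(\<lambda>(i, p). (cons_monom i (fst p), cons_monom (k - i) (snd p)))
          ((\<lambda>(a, b). (Poly_Mapping.lookup a 0, Poly_Mapping.map_key Suc a, Poly_Mapping.map_key Suc b)) q) = q"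
        "(\<lambda>(a, b). (Poly_Mapping.lookup a 0, Poly_Mapping.map_key Suc a, Poly_Mapping.map_key Suc b)) q
          \<in> {..k} \<times> ?S"
        using ij by (auto simp: q(1) a b tl) }
  qed (auto simp: x0coeff_def)
  finally show ?thesis by (simp add: x0coeff_def series_mult_def)
qed

section \<open>Truncation to finitely many variables\<close>

text \<open>
  The result of setting all variables from index \<open>n\<close> on to 0. A series of bounded degree has only
  finitely many monomials in finitely many variables, so it becomes a polynomial, that is, an
  element of an integral domain. (For a series of unbounded degree, the function under
  \<open>Abs_poly_mapping\<close> need not have finite support.)
\<close>

definition trunc_poly :: "nat \<Rightarrow> 'a::zero series \<Rightarrow> monom \<Rightarrow>\<^sub>0 'a" where
  "trunc_poly n f = Abs_poly_mapping (\<lambda>m. if Poly_Mapping.keys m \<subseteq> {..<n} then f m else 0)"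

lemma lookup_trunc_poly:
  assumes "bounded_degree f"
  shows "Poly_Mapping.lookup (trunc_poly n f) = (\<lambda>m. if Poly_Mapping.keys m \<subseteq> {..<n} then f m else 0)"
proof -
  obtain d where d: "\<And>m. f m \<noteq> 0 \<Longrightarrow> mdegree m \<le> d" using assms unfolding bounded_degree_def by blast
  have "finite {m. (if Poly_Mapping.keys m \<subseteq> {..<n} then f m else 0) \<noteq> 0}"
    by (rule finite_subset[OF _ finite_monoms_bounded_degree[of "{..<n}" d]]) (auto simp: d)
  then show ?thesis unfolding trunc_poly_def by simp
qed

text \<open>
  A monomial in the first \<open>n\<close> variables only splits into monomials of the same kind, and any other
  monomial has, in each splitting, a factor that the truncation kills.
\<close>

lemma trunc_poly_mult:
  assumes "bounded_degree f" "bounded_degree g"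
  shows "trunc_poly n (f \<odot> g) = trunc_poly n f * trunc_poly n g"
proof (rule poly_mapping_eqI)
  fix m :: monom
  let ?f = "Poly_Mapping.lookup (trunc_poly n f)" and ?g = "Poly_Mapping.lookup (trunc_poly n g)"
  let ?S = "{(a, b). a + b = m}"
  have "Poly_Mapping.lookup (trunc_poly n f * trunc_poly n g) m = (\<Sum>(a, b). ?f a * ?g b when m = a + b)"
    by (simp add: times_poly_mapping.rep_eq prod_fun_unfold_prod)
  also have "\<dots> = (\<Sum>(a, b)\<in>?S. ?f a * ?g b when m = a + b)"
    by (rule Sum_any.expand_superset[OF finite_monom_splittings]) auto
  also have "\<dots> = (\<Sum>(a, b)\<in>?S. if Poly_Mapping.keys m \<subseteq> {..<n} then f a * g b else 0)"
    by (rule sum.cong) (auto simp: lookup_trunc_poly assms keys_add_monom)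
  also have "\<dots> = Poly_Mapping.lookup (trunc_poly n (f \<odot> g)) m"
    by (simp add: lookup_trunc_poly bounded_degree_mult assms) (simp add: series_mult_def split_def)
  finally show "Poly_Mapping.lookup (trunc_poly n (f \<odot> g)) m
      = Poly_Mapping.lookup (trunc_poly n f * trunc_poly n g) m" ..
qed

text \<open>
  The image of \<open>f\<close> in the ring $R[x_0]$, where $R$ consists of the polynomials in the first \<open>n\<close> of the
  renumbered remaining variables, hence in $x_1, \ldots, x_n$.
\<close>

definition poly_in_x0 :: "nat \<Rightarrow> 'a::zero series \<Rightarrow> (monom \<Rightarrow>\<^sub>0 'a) poly" where
  "poly_in_x0 n f = Abs_poly (\<lambda>k. trunc_poly n (x0coeff f k))"

lemma coeff_poly_in_x0:
  assumes "bounded_degree f"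
  shows "coeff (poly_in_x0 n f) k = trunc_poly n (x0coeff f k)"
proof -
  obtain d where d: "\<And>m. f m \<noteq> 0 \<Longrightarrow> mdegree m \<le> d" using assms unfolding bounded_degree_def by blast
  have "trunc_poly n (x0coeff f k) = 0" if "k > d" for k
  proof -
    have "x0coeff f k = (\<lambda>_. 0)" using that d by (force simp: x0coeff_def mdegree_cons_monom)
    then show ?thesis by (simp add: trunc_poly_def)
  qed
  then show ?thesis unfolding poly_in_x0_def by (subst coeff_Abs_poly) auto
qed

lemma lookup_coeff_poly_in_x0:
  assumes "bounded_degree f"
  shows "Poly_Mapping.lookup (coeff (poly_in_x0 n f) k) m
    = (if Poly_Mapping.keys m \<subseteq> {..<n} then f (cons_monom k m) else 0)"
  by (simp add: coeff_poly_in_x0 lookup_trunc_poly bounded_degree_x0coeff assms) (simp add: x0coeff_def)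

lemma poly_in_x0_mult:
  assumes "bounded_degree f" "bounded_degree g"
  shows "poly_in_x0 n (f \<odot> g) = poly_in_x0 n f * poly_in_x0 n g"
proof (rule poly_eqI, rule poly_mapping_eqI)
  fix k m
  let ?h = "\<lambda>i. x0coeff f i \<odot> x0coeff g (k - i)"
  have b: "bounded_degree (?h i)" for i
    by (intro bounded_degree_mult bounded_degree_x0coeff assms)
  have "Poly_Mapping.lookup (coeff (poly_in_x0 n f * poly_in_x0 n g) k) m
      = (\<Sum>i\<le>k. Poly_Mapping.lookup (trunc_poly n (?h i)) m)"
    by (simp add: coeff_mult lookup_sum coeff_poly_in_x0 assms trunc_poly_mult bounded_degree_x0coeff)
  also have "\<dots> = Poly_Mapping.lookup (coeff (poly_in_x0 n (f \<odot> g)) k) m"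
    by (simp add: lookup_trunc_poly b coeff_poly_in_x0 bounded_degree_mult assms bounded_degree_x0coeff x0coeff_mult)
  finally show "Poly_Mapping.lookup (coeff (poly_in_x0 n (f \<odot> g)) k) m
      = Poly_Mapping.lookup (coeff (poly_in_x0 n f * poly_in_x0 n g) k) m" ..
qed

lemma degree_poly_in_x0_le:
  assumes "\<And>m. f m \<noteq> 0 \<Longrightarrow> mdegree m \<le> d"
  shows "degree (poly_in_x0 n f) \<le> d"
proof (rule degree_le, intro allI impI)
  fix k assume "d < k"
  have "bounded_degree f" using assms by (auto simp: bounded_degree_def)
  moreover have "f (cons_monom k m) = 0" for m
    using assms[of "cons_monom k m"] \<open>d < k\<close> by (auto simp: mdegree_cons_monom)
  ultimately show "coeff (poly_in_x0 n f) k = 0"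
    by (intro poly_mapping_eqI) (simp add: lookup_coeff_poly_in_x0)
qed

lemma poly_in_x0_eqD:
  assumes "poly_in_x0 n f = poly_in_x0 n g" "bounded_degree f" "bounded_degree g"
    and "Poly_Mapping.keys M \<subseteq> {..n}"
  shows "f M = g M"
proof -
  obtain k m where M: "M = cons_monom k m" by (rule cons_monom_exhaust)
  have "Poly_Mapping.keys m \<subseteq> {..<n}" using assms(4) by (auto simp: M keys_cons_monom)
  then show ?thesis
    using arg_cong[OF assms(1), of "\<lambda>p. Poly_Mapping.lookup (coeff p k) m"]
    by (simp add: lookup_coeff_poly_in_x0 assms(2,3) M)
qed

section \<open>Quasisymmetric and symmetric series through compositions\<close>

lemma monom_of_Nil [simp]: "monom_of [] \<alpha> = 0" "monom_of is [] = 0"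
  by (cases "is"; simp add: monom_of_def)+

lemma monom_of_Cons [simp]: "monom_of (i # is) (a # \<alpha>) = Poly_Mapping.single i a + monom_of is \<alpha>"
  by (simp add: monom_of_def)

lemma monom_of_append:
  "length is = length \<alpha> \<Longrightarrow> monom_of (is @ js) (\<alpha> @ \<beta>) = monom_of is \<alpha> + monom_of js \<beta>"
  by (induction "is" \<alpha> rule: list_induct2) (simp_all add: add.assoc)

lemma keys_monom_of_subset: "length is = length \<alpha> \<Longrightarrow> Poly_Mapping.keys (monom_of is \<alpha>) \<subseteq> set is"
  by (induction "is" \<alpha> rule: list_induct2) (auto simp: keys_add_monom)

lemma lookup_monom_of_map:
  "distinct is \<Longrightarrow> Poly_Mapping.lookup (monom_of is (map h is)) i = (if i \<in> set is then h i else 0)"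
  by (induction "is") (auto simp: lookup_add lookup_single when_def)

lemma monom_of_exponents:
  fixes M :: monom
  defines "ks \<equiv> sorted_list_of_set (Poly_Mapping.keys M)"
  shows "monom_of ks (map (Poly_Mapping.lookup M) ks) = M"
  by (rule poly_mapping_eqI) (auto simp: lookup_monom_of_map ks_def in_keys_iff)

lemma cons_monom_monom_of:
  "length is = length \<alpha> \<Longrightarrow> cons_monom k (monom_of is \<alpha>) = Poly_Mapping.single 0 k + monom_of (map Suc is) \<alpha>"
proof (induction "is" \<alpha> rule: list_induct2)
  case Nil
  show ?case by (rule cons_monom_eqI[symmetric]) (auto simp: lookup_single when_def)
next
  case (Cons i "is" a \<alpha>)
  have "cons_monom k (Poly_Mapping.single i a + m) = Poly_Mapping.single (Suc i) a + cons_monom k m" for m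
    by (rule cons_monom_eqI[symmetric]) (auto simp: lookup_add lookup_single when_def)
  then show ?case by (simp add: Cons.IH add.left_commute)
qed

lemma map_key_monom_of:
  assumes "\<And>i. \<tau> (\<tau> i) = i" "length is = length \<alpha>"
  shows "Poly_Mapping.map_key \<tau> (monom_of is \<alpha>) = monom_of (map \<tau> is) \<alpha>"
proof -
  have inj: "inj \<tau>" by (metis assms(1) injI)
  have single: "Poly_Mapping.map_key \<tau> (Poly_Mapping.single i a) = Poly_Mapping.single (\<tau> i) a" for i and a :: nat
    using map_key_single[OF inj, of "\<tau> i" a] by (simp add: assms(1))
  show ?thesis using assms(2)
    by (induction "is" \<alpha> rule: list_induct2) (simp_all add: inj map_key_plus single)
qed

definition comp_coeff :: "'a series \<Rightarrow> nat list \<Rightarrow> 'a" where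
  "comp_coeff f \<alpha> = f (monom_of [0..<length \<alpha>] \<alpha>)"

lemma quasisymmetricD:
  assumes "quasisymmetric f" "composition \<alpha>" "length is = length \<alpha>" "sorted_wrt (<) is"
  shows "f (monom_of is \<alpha>) = comp_coeff f \<alpha>"
  using assms unfolding quasisymmetric_def comp_coeff_def by blast

lemma quasisymmetric_eq_comp_coeff:
  assumes "quasisymmetric f"
  defines "ks M \<equiv> sorted_list_of_set (Poly_Mapping.keys M)"
  shows "f M = comp_coeff f (map (Poly_Mapping.lookup M) (ks M))"
    and "composition (map (Poly_Mapping.lookup M) (ks M))"
proof -
  show *: "composition (map (Poly_Mapping.lookup M) (ks M))"
    by (auto simp: composition_def ks_def in_keys_iff)
  have "f (monom_of (ks M) (map (Poly_Mapping.lookup M) (ks M))) = comp_coeff f (map (Poly_Mapping.lookup M) (ks M))"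
    by (rule quasisymmetricD[OF assms(1) *]) (simp_all add: ks_def)
  then show "f M = comp_coeff f (map (Poly_Mapping.lookup M) (ks M))"
    by (simp add: ks_def monom_of_exponents)
qed

text \<open>
  The coefficient of a quasisymmetric series at a monomial depends only on the sequence of its nonzero
  exponents, listed by increasing index. A permutation of the variables rearranges that sequence.
\<close>

lemma symmetricI_adjacent_swaps:
  assumes f: "quasisymmetric f"
    and swap: "\<And>us x y vs. composition (us @ [x, y] @ vs) \<Longrightarrow>
      comp_coeff f (us @ [x, y] @ vs) = comp_coeff f (us @ [y, x] @ vs)"
  shows "symmetric f"
proof -
  have "permute_vars \<pi> f M = f M" if "bij \<pi>" for \<pi> M
  proof -
    have inj: "inj \<pi>" using that by (rule bij_is_inj)
    let ?N = "Poly_Mapping.map_key \<pi> M"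
    \<comment> \<open>The exponent sequence of a monomial, and that of its permuted version below, have
      the same multiset of entries.\<close>
    let ?\<alpha> = "\<lambda>M. map (Poly_Mapping.lookup M) (sorted_list_of_set (Poly_Mapping.keys M))"
    have mset: "mset (?\<alpha> M) = image_mset (Poly_Mapping.lookup M) (mset_set (Poly_Mapping.keys M))" for M :: monom
      by (simp flip: sorted_list_of_mset_set)
    have "mset (?\<alpha> ?N) = image_mset (Poly_Mapping.lookup M) (image_mset \<pi> (mset_set (\<pi> -` Poly_Mapping.keys M)))"
      unfolding mset by (simp add: keys_map_key map_key.rep_eq inj multiset.map_comp)
    also have "image_mset \<pi> (mset_set (\<pi> -` Poly_Mapping.keys M)) = mset_set (\<pi> ` (\<pi> -` Poly_Mapping.keys M))"
      by (rule image_mset_mset_set) (rule inj_on_subset[OF inj], simp)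
    also have "\<pi> ` (\<pi> -` Poly_Mapping.keys M) = Poly_Mapping.keys M"
      using that by (simp add: bij_is_surj)
    finally have "mset (?\<alpha> ?N) = mset (?\<alpha> M)" unfolding mset[of M] .
    then have "comp_coeff f (?\<alpha> ?N) = comp_coeff f (?\<alpha> M)"
    proof (rule mset_eq_imp_eq_if_adjacent_swap_invariant[where A = "{0<..}", rotated 2])
      show "set (?\<alpha> ?N) \<subseteq> {0<..}"
        using quasisymmetric_eq_comp_coeff(2)[OF f, of ?N] by (auto simp: composition_def)
      show "comp_coeff f (us @ [x, y] @ vs) = comp_coeff f (us @ [y, x] @ vs)"
        if "set (us @ [x, y] @ vs) \<subseteq> {0<..}" for us x y vs
        using that by (intro swap) (auto simp: composition_def)
    qed
    then show ?thesis
      unfolding permute_vars_def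
      using quasisymmetric_eq_comp_coeff(1)[OF f, of ?N] quasisymmetric_eq_comp_coeff(1)[OF f, of M]
      by (simp only:)
  qed
  then show ?thesis using f unfolding symmetric_def quasisymmetric_def by blast
qed

text \<open>
  Fixing the exponent \<open>k\<close> of $x_0$ prepends \<open>k\<close> to the composition; \<open>k = 0\<close> is separate because parts
  of a composition are positive.
\<close>

lemma quasisymmetric_x0coeff:
  assumes "quasisymmetric f"
  shows "quasisymmetric (x0coeff f k)"
proof -
  have "x0coeff f k (monom_of is \<alpha>) = comp_coeff f (if k = 0 then \<alpha> else k # \<alpha>)"
    if "composition \<alpha>" "length is = length \<alpha>" "sorted_wrt (<) is" for \<alpha> "is"
  proof (cases "k = 0")
    case True
    then show ?thesis
      using that assms quasisymmetricD[of f \<alpha> "map Suc is"]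
      by (simp add: x0coeff_def cons_monom_monom_of sorted_wrt_map)
  next
    case False
    then show ?thesis
      using that assms quasisymmetricD[of f "k # \<alpha>" "0 # map Suc is"]
      by (simp add: x0coeff_def cons_monom_monom_of sorted_wrt_map composition_def)
  qed
  then show ?thesis
    using assms by (simp add: quasisymmetric_def bounded_degree_x0coeff)
qed

lemma symmetric_x0coeff:
  assumes "symmetric F"
  shows "symmetric (x0coeff F k)"
  using assms x0coeff_permute_vars[of _ F k] bij_fix0
  by (metis symmetric_def bounded_degree_x0coeff bij_is_inj)

lemma top_x0coeff_exists:
  assumes "bounded_degree f" "f \<noteq> (\<lambda>_. 0)"
  obtains a where "x0coeff f a \<noteq> (\<lambda>_. 0)" "\<And>i. i > a \<Longrightarrow> x0coeff f i = (\<lambda>_. 0)"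
proof -
  let ?P = "\<lambda>i. x0coeff f i \<noteq> (\<lambda>_. 0)"
  obtain M where "f M \<noteq> 0" using assms(2) by auto
  then obtain k where k: "?P k" by (metis cons_monom_exhaust x0coeff_def)
  obtain d where d: "\<And>m. f m \<noteq> 0 \<Longrightarrow> mdegree m \<le> d"
    using assms(1) unfolding bounded_degree_def by blast
  have le: "i \<le> d" if "?P i" for i
  proof -
    from that obtain m where "f (cons_monom i m) \<noteq> 0" by (auto simp: x0coeff_def)
    from d[OF this] show "i \<le> d" by (simp add: mdegree_cons_monom)
  qed
  show ?thesis
  proof (rule that)
    show "?P (GREATEST i. ?P i)" by (rule GreatestI_nat[of ?P, OF k le])
    show "x0coeff f i = (\<lambda>_. 0)" if "i > (GREATEST i. ?P i)" for i
      using that Greatest_le_nat[of ?P i d, OF _ le] by (meson not_less)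
  qed
qed

lemma x0coeff_mult_top:
  assumes "\<And>i. i > a \<Longrightarrow> x0coeff f i = (\<lambda>_. 0)" "\<And>i. i > b \<Longrightarrow> x0coeff g i = (\<lambda>_. 0)"
  shows "x0coeff (f \<odot> g) (a + b) = x0coeff f a \<odot> x0coeff g b"
proof
  fix m
  have "(x0coeff f i \<odot> x0coeff g (a + b - i)) m = 0" if "i \<noteq> a" for i
    using that assms(1)[of i] assms(2)[of "a + b - i"]
    by (cases "i > a") (simp_all add: series_mult_def)
  then have "(\<Sum>i\<le>a + b. (x0coeff f i \<odot> x0coeff g (a + b - i)) m)
      = (\<Sum>i\<in>{a}. (x0coeff f i \<odot> x0coeff g (a + b - i)) m)"
    by (intro sum.mono_neutral_right) auto
  then show "x0coeff (f \<odot> g) (a + b) m = (x0coeff f a \<odot> x0coeff g b) m"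
    by (simp add: x0coeff_mult)
qed

text \<open>
  By quasisymmetry the coefficient at any monomial other than 1 equals the coefficient at a
  monomial that contains $x_0$, so it vanishes and \<open>f\<close> is constant.
\<close>

lemma symmetric_if_free_of_x0:
  assumes f: "quasisymmetric f" and "\<And>i. i > 0 \<Longrightarrow> x0coeff f i = (\<lambda>_. 0)"
  shows "symmetric f"
proof (rule symmetricI_adjacent_swaps[OF f])
  have "comp_coeff f (a # \<alpha>) = 0" if "a > 0" for a \<alpha>
  proof -
    obtain k m where M: "monom_of [0..<length (a # \<alpha>)] (a # \<alpha>) = cons_monom k m"
      by (rule cons_monom_exhaust)
    have "k = Poly_Mapping.lookup (monom_of [0..<length (a # \<alpha>)] (a # \<alpha>)) 0"
      by (simp only: M lookup_cons_monom_simps)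
    also have "\<dots> \<ge> a" by (simp add: upt_conv_Cons lookup_add del: upt_Suc)
    finally have "k > 0" using that by simp
    from fun_cong[OF assms(2)[OF this], of m] show ?thesis
      unfolding comp_coeff_def M by (simp add: x0coeff_def)
  qed
  then have *: "comp_coeff f \<alpha> = 0" if "composition \<alpha>" "\<alpha> \<noteq> []" for \<alpha>
    using that by (cases \<alpha>) (auto simp: composition_def)
  fix us x y vs assume "composition (us @ [x, y] @ vs)"
  then show "comp_coeff f (us @ [x, y] @ vs) = comp_coeff f (us @ [y, x] @ vs)"
    by (subst (1 2) *) (auto simp: composition_def)
qed

lemma fix0_transpose: "fix0 (transpose i j) = transpose (Suc i) (Suc j)"
proof
  fix l show "fix0 (transpose i j) l = transpose (Suc i) (Suc j) l"
    by (cases l) (auto simp: fix0_def transpose_def)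
qed

text \<open>
  The pigeonhole argument: the truncations of $\tau_j f$ are divisors of one polynomial with one leading
  coefficient, so two of them coincide as soon as there are more than $2^d$ indices $j$.
\<close>

lemma adjacent_swap_if_top_x0coeff_symmetric:
  fixes f g :: "'a::idom series"
  assumes f: "quasisymmetric f" and g: "bounded_degree g" "g \<noteq> (\<lambda>_. 0)"
    and F: "symmetric (f \<odot> g)"
    and top: "x0coeff f a \<noteq> (\<lambda>_. 0)" "\<And>i. i > a \<Longrightarrow> x0coeff f i = (\<lambda>_. 0)" "symmetric (x0coeff f a)"
    and \<alpha>: "composition (us @ [x, y] @ vs)"
  shows "comp_coeff f (us @ [x, y] @ vs) = comp_coeff f (us @ [y, x] @ vs)"
proof -
  have bf: "bounded_degree f" using f by (simp add: quasisymmetric_def)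
  obtain d where d: "\<And>m. (f \<odot> g) m \<noteq> 0 \<Longrightarrow> mdegree m \<le> d"
    using bounded_degree_mult[OF bf g(1)] unfolding bounded_degree_def by blast
  define p where "p = length us"
  \<comment> \<open>Position \<open>2 * j + 1\<close> leaves room for the parts \<open>us\<close> in
    front, and all positions from \<open>L\<close> on are above every variable that is moved, which
    leaves room for \<open>vs\<close>.\<close>
  define J where "J = {p..p + 2 ^ d}"
  define L where "L = 2 * (p + 2 ^ d) + 3"
  obtain m1 where m1: "x0coeff f a m1 \<noteq> 0" using top(1) by auto
  obtain M2 where M2: "g M2 \<noteq> 0" using g(2) by auto
  obtain k2 m2 where m2: "M2 = cons_monom k2 m2" by (rule cons_monom_exhaust)
  \<comment> \<open>The truncation must keep the leading coefficient of \<open>f\<close> and some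
    coefficient of \<open>g\<close> nonzero, and must keep all variables of the test monomial.\<close>
  obtain n where n: "\<And>i. i \<in> Poly_Mapping.keys m1 \<union> Poly_Mapping.keys m2 \<union> {..L + length vs} \<Longrightarrow> i < n"
    by (meson finite_nat_set_iff_bounded finite_Un finite_keys finite_atMost)
  \<comment> \<open>\<open>\<tau> j\<close> moves variables of positive index only; on the renumbered
    variables of the coefficients it acts as \<open>\<rho> j\<close>.\<close>
  define \<rho> where "\<rho> j = transpose (2 * j) (2 * j + 1 :: nat)" for j
  define \<tau> where "\<tau> j = transpose (2 * j + 1) (2 * j + 2 :: nat)" for j
  have \<tau>: "\<tau> j = fix0 (\<rho> j)" "bij (\<tau> j)" "bij (\<rho> j)" "inj (\<rho> j)" for j
    by (simp_all add: \<tau>_def \<rho>_def fix0_transpose bij_is_inj)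
  define P where "P j = poly_in_x0 n (permute_vars (\<tau> j) f)" for j
  define Q where "Q = poly_in_x0 n (f \<odot> g)"

  have "P j dvd Q" for j
  proof -
    have "Q = poly_in_x0 n (permute_vars (\<tau> j) (f \<odot> g))"
      using F \<tau>(2)[of j] unfolding symmetric_def Q_def by simp
    also have "\<dots> = P j * poly_in_x0 n (permute_vars (\<tau> j) g)"
      by (simp add: P_def permute_vars_mult \<tau>(2) poly_in_x0_mult bounded_degree_permute_vars bf g(1))
    finally show ?thesis by simp
  qed
  have coeff_P: "coeff (P j) i = trunc_poly n (permute_vars (\<rho> j) (x0coeff f i))" for i j
    by (simp add: P_def coeff_poly_in_x0 bounded_degree_permute_vars bf \<tau>(2))
       (simp add: \<tau>(1) x0coeff_permute_vars \<tau>(4))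
  have coeff_top: "coeff (P j) a = trunc_poly n (x0coeff f a)" for j
    using top(3) \<tau>(3)[of j] by (simp add: coeff_P symmetric_def)
  have m1_n: "Poly_Mapping.keys m1 \<subseteq> {..<n}" "Poly_Mapping.keys m2 \<subseteq> {..<n}" using n by auto
  have "Poly_Mapping.lookup (trunc_poly n (x0coeff f a)) m1 \<noteq> 0"
    using m1 m1_n by (simp add: lookup_trunc_poly bounded_degree_x0coeff bf)
  then have top_nz: "trunc_poly n (x0coeff f a) \<noteq> 0" by auto
  have deg_P: "degree (P j) = a" for j
  proof (rule antisym)
    show "degree (P j) \<le> a"
      by (rule degree_le) (simp add: coeff_P top(2) permute_vars_def trunc_poly_def)
    show "a \<le> degree (P j)"
      by (rule le_degree) (simp add: coeff_top top_nz)
  qed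
  have "Q \<noteq> 0"
  proof -
    have "coeff (poly_in_x0 n f) a \<noteq> 0" using top_nz by (simp add: coeff_poly_in_x0 bf)
    moreover have "Poly_Mapping.lookup (coeff (poly_in_x0 n g) k2) m2 \<noteq> 0"
      using M2 m1_n by (simp add: lookup_coeff_poly_in_x0 g(1) m2)
    ultimately show ?thesis
      unfolding Q_def poly_in_x0_mult[OF bf g(1)] by (metis coeff_0 lookup_zero mult_eq_0_iff)
  qed
  have "\<not> inj_on P J"
  proof
    assume inj: "inj_on P J"
    let ?D = "{q. q dvd Q \<and> lead_coeff q = trunc_poly n (x0coeff f a)}"
    have "P ` J \<subseteq> ?D" using \<open>\<And>j. P j dvd Q\<close> by (auto simp: deg_P coeff_top)
    then have "card J \<le> card ?D"
      using card_inj_on_le[OF inj] card_poly_divisors_with_lead_coeff(1)[OF \<open>Q \<noteq> 0\<close>] by blast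
    also have "\<dots> \<le> 2 ^ degree Q" by (rule card_poly_divisors_with_lead_coeff(2)[OF \<open>Q \<noteq> 0\<close>])
    also have "\<dots> \<le> 2 ^ d"
      unfolding Q_def by (intro power_increasing degree_poly_in_x0_le d) auto
    finally show False by (simp add: J_def)
  qed
  then obtain j k where jk: "j \<in> J" "k \<in> J" "j \<noteq> k" "P j = P k" by (auto simp: inj_on_def)

  \<comment> \<open>The parts \<open>x\<close> and \<open>y\<close> sit exactly on the two variables that
    \<open>\<tau> j\<close> exchanges, and no part sits on those of \<open>\<tau> k\<close>.\<close>
  define js where "js = [0..<p] @ [2 * j + 1, 2 * j + 2] @ [L..<L + length vs]"
  let ?M = "\<lambda>is. monom_of is (us @ [x, y] @ vs)"
  have len: "length js = length (us @ [x, y] @ vs)" "length js = length (us @ [y, x] @ vs)"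
    by (simp_all add: js_def p_def)
  have bounds: "p \<le> j" "p \<le> k" "2 * j + 2 < L" "2 * k + 2 < L"
    using jk by (auto simp: J_def L_def)
  have sorted: "sorted_wrt (<) js"
    using bounds by (auto simp: js_def sorted_wrt_append)
  have "set js \<subseteq> {..n}"
    using n[of "L + length vs"] bounds by (auto simp: js_def)
  then have keys: "Poly_Mapping.keys (?M js) \<subseteq> {..n}"
    using keys_monom_of_subset[OF len(1)] by blast
  have map_\<tau>: "Poly_Mapping.map_key (\<tau> i) (?M js) = ?M (map (\<tau> i) js)" for i
    by (rule map_key_monom_of[OF _ len(1)]) (simp add: \<tau>_def)
  have "comp_coeff f (us @ [x, y] @ vs) = f (?M js)"
    by (rule quasisymmetricD[OF f \<alpha> len(1) sorted, symmetric])
  also have "map (\<tau> k) js = js"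
    using bounds jk(3) by (auto simp: js_def \<tau>_def transpose_def intro!: map_idI)
  then have "f (?M js) = permute_vars (\<tau> k) f (?M js)"
    by (simp only: permute_vars_def map_\<tau>)
  also have "\<dots> = permute_vars (\<tau> j) f (?M js)"
    by (rule poly_in_x0_eqD[OF jk(4)[unfolded P_def, symmetric] _ _ keys])
       (rule bounded_degree_permute_vars[OF \<tau>(2) bf])+
  also have "\<dots> = f (?M (map (\<tau> j) js))" by (simp only: permute_vars_def map_\<tau>)
  also have "map (\<tau> j) js = [0..<p] @ [2 * j + 2, 2 * j + 1] @ [L..<L + length vs]"
  proof -
    have "map (\<tau> j) [0..<p] = [0..<p]" "map (\<tau> j) [L..<L + length vs] = [L..<L + length vs]"
      using bounds by (intro map_idI; simp add: \<tau>_def transpose_def)+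
    then show ?thesis by (simp add: js_def \<tau>_def)
  qed
  also have "?M \<dots> = monom_of js (us @ [y, x] @ vs)"
    unfolding js_def by (simp add: monom_of_append p_def add_ac)
  also have "f \<dots> = comp_coeff f (us @ [y, x] @ vs)"
    using \<alpha> by (intro quasisymmetricD[OF f _ len(2) sorted]) (auto simp: composition_def)
  finally show ?thesis .
qed

text \<open>
  Only the degree of \<open>f\<close> decreases in the induction: the leading coefficient of \<open>g\<close> may have the same degree
  as \<open>g\<close>. The case of a series free of $x_0$ takes the place of the induction base.
\<close>

lemma symmetric_if_mult_symmetric:
  fixes f g :: "'a::idom series"
  assumes "quasisymmetric f" "quasisymmetric g" "f \<noteq> (\<lambda>_. 0)" "g \<noteq> (\<lambda>_. 0)"
    and "symmetric (f \<odot> g)" and "\<And>m. f m \<noteq> 0 \<Longrightarrow> mdegree m \<le> d"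
  shows "symmetric f"
  using assms
proof (induction d arbitrary: f g rule: less_induct)
  case (less d)
  have bd: "bounded_degree f" "bounded_degree g" using less.prems(1,2) by (simp_all add: quasisymmetric_def)
  obtain a where a: "x0coeff f a \<noteq> (\<lambda>_. 0)" "\<And>i. i > a \<Longrightarrow> x0coeff f i = (\<lambda>_. 0)"
    using top_x0coeff_exists[OF bd(1) less.prems(3)] by metis
  obtain b where b: "x0coeff g b \<noteq> (\<lambda>_. 0)" "\<And>i. i > b \<Longrightarrow> x0coeff g i = (\<lambda>_. 0)"
    using top_x0coeff_exists[OF bd(2) less.prems(4)] by metis
  show ?case
  proof (cases "a = 0")
    case True
    then show ?thesis using a(2) less.prems(1) by (intro symmetric_if_free_of_x0) auto
  next
    case False
    have deg: "a + mdegree m \<le> d" if "x0coeff f a m \<noteq> 0" for m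
      using that less.prems(6) by (metis x0coeff_def mdegree_cons_monom)
    have "a \<le> d" using a(1) deg by (metis add_leD1)
    have "symmetric (x0coeff f a)"
    proof (rule less.IH[of "d - a"])
      show "d - a < d" using False \<open>a \<le> d\<close> by simp
      show "symmetric (x0coeff f a \<odot> x0coeff g b)"
        using symmetric_x0coeff[OF less.prems(5)] x0coeff_mult_top[OF a(2) b(2)] by metis
      show "mdegree m \<le> d - a" if "x0coeff f a m \<noteq> 0" for m using deg[OF that] by simp
    qed (use a b less.prems quasisymmetric_x0coeff in auto)
    then show ?thesis
      using adjacent_swap_if_top_x0coeff_symmetric[OF less.prems(1) bd(2) less.prems(4,5) a]
      by (intro symmetricI_adjacent_swaps[OF less.prems(1)])
  qed
qed

theorem theorem1p4:
  fixes f g :: "int series"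
  assumes "quasisymmetric f" and "quasisymmetric g"
    and "f \<noteq> (\<lambda>_. 0)" and "g \<noteq> (\<lambda>_. 0)"
    and "symmetric (f \<odot> g)"
  shows "symmetric f \<and> symmetric g"
proof -
  obtain d e where "\<And>m. f m \<noteq> 0 \<Longrightarrow> mdegree m \<le> d" "\<And>m. g m \<noteq> 0 \<Longrightarrow> mdegree m \<le> e"
    using assms(1,2) unfolding quasisymmetric_def bounded_degree_def by blast
  moreover have "symmetric (g \<odot> f)" using assms(5) by (simp add: series_mult_commute)
  ultimately show ?thesis using assms symmetric_if_mult_symmetric by metis
qed

end
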